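(* Let $(T(t))_{t\in\Delta}$ be a hypercyclic $C_0$-semigroup on $E$. Then there exist an increasing mapping $f:[0,\infty)\to[1,\infty)$ and a vector $x\in E$ such that $(T(t))_{t\in\Delta}$ is $f$-frequently hypercyclic with $f$-frequently hypercyclic vector $x$ and, for every open non-empty subset $V$ of $E$, $$\underline d_f(\{t\in\Delta: T(t)x\in V\})=+\infty .$$
   Context: $E$ is a separable infinite-dimensional Fréchet space over $\mathbb K\in\{\mathbb R,\mathbb C\}$. The index set $\Delta$ is one of $[0,\infty)$, $\mathbb R$, $\mathbb C$, or $\Delta(\alpha):=\{re^{i\theta}: r\ge 0,\ \theta\in[-\alpha,\alpha]\}$ for some $\alpha\in(0,\pi/2]$. For $s\ge0$, $\Delta_s:=\{t\in\Delta:|t|\le s\}$; $m(\cdot)$ is Lebesgue measure on $\Delta$. A $C_0$-semigroup $(T(t))_{t\in\Delta}$ on $E$ is a family of continuous linear operators on $E$ with $T(0)=I$, $T(t+s)=T(t)T(s)$ for $t,s\in\Delta$, and $t\mapsto T(t)x$ continuous for each $x\in E$; it is locally equicontinuous, i.e. $\{T(t):t\in\Delta_{t_0}\}$ is equicontinuous for every $t_0>0$. It is hypercyclic if there is $x\in E$ such that $\{t\in\Delta:T(t)x\in V\}\neq\emptyset$ for every open non-empty $V\subseteq E$. For $A\subseteq\Delta$ and an increasing $f:[0,\infty)\to[1,\infty)$, the lower $f$-density is $\underline d_f(A):=\liminf_{t\to\infty}m(A\cap\Delta_{f(t)})/t$. A vector $x$ is an $f$-frequently hypercyclic vector of $(T(t))_{t\in\Delta}$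 if $\underline d_f(\{t\in\Delta:T(t)x\in V\})>0$ for every open non-empty $V\subseteq E$; the semigroup is $f$-frequently hypercyclic if it has such a vector. *)

theory Defs
  imports "HOL-Analysis.Analysis"
begin

section \<open>Frechet spaces\<close>

text \<open>
  The scalar field ranges over the type class \<^class>\<open>real_normed_field\<close>, whose norm is
  multiplicative.  By the Gelfand-Mazur theorem for real normed division algebras, its instances
  are, up to isometric isomorphism, exactly the real and the complex numbers.
\<close>

definition seminorm :: "('k::real_normed_field \<Rightarrow> 'e::ab_group_add \<Rightarrow> 'e) \<Rightarrow> ('e \<Rightarrow> real) \<Rightarrow> bool"
  where "seminorm smul p \<longleftrightarrow>
    (\<forall>x y. p (x + y) \<le> p x + p y) \<and> (\<forall>c x. p (smul c x) = norm c * p x)"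

text \<open>
  A Frechet space carries a separating sequence of seminorms that generates its topology (so the
  topology is Hausdorff, locally convex and metrizable) and for which it is complete.  The seminorms
  are not part of the structure; only the topology is.
\<close>

locale frechet_space = vector_space smul
  for smul :: "'k::real_normed_field \<Rightarrow> 'e::{ab_group_add, topological_space} \<Rightarrow> 'e" +
  assumes generating_seminorms:
    "\<exists>p :: nat \<Rightarrow> 'e \<Rightarrow> real.
       (\<forall>n. seminorm smul (p n)) \<and>
       (\<forall>x. (\<forall>n. p n x = 0) \<longrightarrow> x = 0) \<and>
       (\<forall>U. open U \<longleftrightarrow>
          (\<forall>x\<in>U. \<exists>N. \<exists>\<epsilon>>0. {y. \<forall>n\<le>N. p n (y - x) < \<epsilon>} \<subseteq> U)) \<and>
       (\<forall>X :: nat \<Rightarrow> 'e.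
          (\<forall>n. \<forall>\<epsilon>>0. \<exists>M. \<forall>i\<ge>M. \<forall>j\<ge>M. p n (X i - X j) < \<epsilon>) \<longrightarrow> (\<exists>x. X \<longlonglongrightarrow> x))"

definition infinite_dimensional :: "('k::field \<Rightarrow> 'e::ab_group_add \<Rightarrow> 'e) \<Rightarrow> bool"
  where "infinite_dimensional smul \<longleftrightarrow> \<not> (\<exists>B. finite B \<and> module.span smul B = UNIV)"

section \<open>Index sets and Lebesgue measure on them\<close>

definition sector :: "real \<Rightarrow> complex set"
  where "sector \<alpha> = {complex_of_real r * cis \<theta> | r \<theta>. 0 \<le> r \<and> - \<alpha> \<le> \<theta> \<and> \<theta> \<le> \<alpha>}"

text \<open>
  All index sets are realised inside the complex plane; the half-line and the line are the sets of
  nonnegative real and of real complex numbers.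
\<close>

definition index_sets :: "complex set set"
  where "index_sets = {\<real>\<^sub>\<ge>\<^sub>0, \<real>, UNIV} \<union> sector ` {0<..pi / 2}"

text \<open>
  Lebesgue measure on an index set is one-dimensional when the index set is the half-line or the
  line, and two-dimensional when it is a sector or the plane.
\<close>

definition index_measure :: "complex set \<Rightarrow> complex set \<Rightarrow> ennreal"
  where "index_measure \<Delta> A =
    (if \<Delta> \<subseteq> \<real> then emeasure lebesgue (complex_of_real -` A) else emeasure lebesgue A)"

definition index_upto :: "complex set \<Rightarrow> real \<Rightarrow> complex set"
  where "index_upto \<Delta> s = {t \<in> \<Delta>. norm t \<le> s}"

definition lower_density :: "complex set \<Rightarrow> (real \<Rightarrow> real) \<Rightarrow> complex set \<Rightarrow> ennreal"
  where "lower_density \<Delta> f A =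
    Liminf at_top (\<lambda>t. index_measure \<Delta> (A \<inter> index_upto \<Delta> (f t)) / ennreal t)"

section \<open>Semigroups and hypercyclicity\<close>

text \<open>
  Local equicontinuity is not assumed: on a Frechet space it follows from strong continuity by the
  uniform boundedness principle.
\<close>

definition C0_semigroup ::
  "('k::real_normed_field \<Rightarrow> 'e::{ab_group_add, topological_space} \<Rightarrow> 'e) \<Rightarrow> complex set \<Rightarrow>
   (complex \<Rightarrow> 'e \<Rightarrow> 'e) \<Rightarrow> bool"
  where "C0_semigroup smul \<Delta> T \<longleftrightarrow>
    (\<forall>t\<in>\<Delta>. Vector_Spaces.linear smul smul (T t) \<and> continuous_on UNIV (T t)) \<and>
    T 0 = id \<and>
    (\<forall>t\<in>\<Delta>. \<forall>s\<in>\<Delta>. T (t + s) = T t \<circ> T s) \<and>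
    (\<forall>x. continuous_on \<Delta> (\<lambda>t. T t x))"

definition hitting_set ::
  "complex set \<Rightarrow> (complex \<Rightarrow> 'e \<Rightarrow> 'e) \<Rightarrow> 'e \<Rightarrow> 'e set \<Rightarrow> complex set"
  where "hitting_set \<Delta> T x V = {t \<in> \<Delta>. T t x \<in> V}"

definition hypercyclic :: "complex set \<Rightarrow> (complex \<Rightarrow> 'e::topological_space \<Rightarrow> 'e) \<Rightarrow> bool"
  where "hypercyclic \<Delta> T \<longleftrightarrow> (\<exists>x. \<forall>V. open V \<and> V \<noteq> {} \<longrightarrow> hitting_set \<Delta> T x V \<noteq> {})"

definition freq_hypercyclic_vector ::
  "complex set \<Rightarrow> (real \<Rightarrow> real) \<Rightarrow> (complex \<Rightarrow> 'e::topological_space \<Rightarrow> 'e) \<Rightarrow> 'e \<Rightarrow> bool"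
  where "freq_hypercyclic_vector \<Delta> f T x \<longleftrightarrow>
    (\<forall>V. open V \<and> V \<noteq> {} \<longrightarrow> lower_density \<Delta> f (hitting_set \<Delta> T x V) > 0)"

definition freq_hypercyclic ::
  "complex set \<Rightarrow> (real \<Rightarrow> real) \<Rightarrow> (complex \<Rightarrow> 'e::topological_space \<Rightarrow> 'e) \<Rightarrow> bool"
  where "freq_hypercyclic \<Delta> f T \<longleftrightarrow> (\<exists>x. freq_hypercyclic_vector \<Delta> f T x)"

end

theory Submission
  imports Defs
begin

text \<open>
  Any hypercyclic vector \<open>x\<close> works, because its hitting sets all have infinite measure; \<open>f\<close> is then
  chosen by diagonalising over a countable family of nonempty open sets refining every nonempty open
  set.  To see that the hitting set of \<open>V\<close> has infinite measure, Baire's theorem gives a nonempty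
  open \<open>W\<close> and \<open>\<delta> > 0\<close> such that \<open>T s\<close> maps \<open>W\<close> into \<open>V\<close> whenever \<open>\<bar>s\<bar> \<le> \<delta>\<close>; so each hitting time
  \<open>t\<close> of \<open>W\<close> contributes the whole piece \<open>t + \<Delta>\<^sub>\<delta>\<close>.  The hitting times of \<open>W\<close> are unbounded, which
  yields infinitely many disjoint pieces: otherwise density of the orbit would put \<open>W\<close> inside a
  compact piece of the orbit, and \<open>E\<close> would be finite-dimensional.
\<close>

section \<open>Graded seminorms\<close>

text \<open>Doubling from one index to the next lets a larger index play the role of a smaller
  radius. Openness and the Cauchy condition can therefore be stated with radius 1 alone, and a
  neighbourhood is described by a single natural number.\<close>

locale graded_frechet_space = vector_space smul
  for smul :: "'k::real_normed_field \<Rightarrow> 'e::{ab_group_add, topological_space} \<Rightarrow> 'e" +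
  fixes r :: "nat \<Rightarrow> 'e \<Rightarrow> real"
  assumes seminorm_r: "seminorm smul (r n)"
    and double_le: "2 * r n x \<le> r (Suc n) x"
    and separating: "(\<And>n. r n x = 0) \<Longrightarrow> x = 0"
    and open_iff: "open U \<longleftrightarrow> (\<forall>x\<in>U. \<exists>N. {y. r N (y - x) < 1} \<subseteq> U)"
    and complete: "(\<And>n. \<exists>M. \<forall>i\<ge>M. \<forall>j\<ge>M. r n (X i - X j) < 1) \<Longrightarrow> \<exists>x. X \<longlonglongrightarrow> x"
begin

section \<open>Seminorm calculus and the topology given by the unit balls\<close>

lemma r_triangle: "r n (x + y) \<le> r n x + r n y"
  using seminorm_r unfolding seminorm_def by blast

lemma r_scale: "r n (smul c x) = norm c * r n x"
  using seminorm_r unfolding seminorm_def by blast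

lemma r_zero [simp]: "r n 0 = 0"
  using r_scale[of n 0 0] by simp

lemma r_uminus: "r n (- x) = r n x"
  using r_scale[of n "-1" x] by simp

lemma r_minus_commute: "r n (x - y) = r n (y - x)"
  using r_uminus[of n "x - y"] by simp

lemma r_nonneg: "0 \<le> r n x"
  using r_triangle[of n x "- x"] by (simp add: r_uminus)

lemma r_diff_triangle: "r n (x - z) \<le> r n (x - y) + r n (y - z)"
  using r_triangle[of n "x - y" "y - z"] by simp

lemma r_sum: "finite B \<Longrightarrow> r n (\<Sum>b\<in>B. g b) \<le> (\<Sum>b\<in>B. r n (g b))"
proof (induction B rule: finite_induct)
  case (insert b B)
  then show ?case using r_triangle[of n "g b" "\<Sum>b\<in>B. g b"] by simp
qed simp

lemma power_two_r_le: "2 ^ k * r n x \<le> r (n + k) x"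
proof (induction k)
  case (Suc k)
  then show ?case using double_le[of "n + k" x] by simp
qed simp

lemma r_mono: "n \<le> m \<Longrightarrow> r n x \<le> r m x"
proof (induction m rule: dec_induct)
  case (step m)
  then show ?case using double_le[of m x] r_nonneg[of m x] by simp
qed simp

text \<open>Raising the index by \<open>k\<close> multiplies the seminorm by at least
  \<open>2 ^ k\<close>, so \<open>k\<close> is chosen with \<open>(1/2) ^ k < e\<close>.\<close>

lemma small_ball_subset:
  assumes "0 < e"
  obtains k where "{z. r (N + k) (z - y) < 1} \<subseteq> {z. r N (z - y) < e}"
proof -
  obtain k where k: "(1/2) ^ k < e"
    using real_arch_pow_inv[OF assms, of "1/2"] by auto
  have "r N (z - y) < e" if "r (N + k) (z - y) < 1" for z
  proof -
    have "2 ^ k * r N (z - y) < 1"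
      using power_two_r_le[of k N "z - y"] that by simp
    then have "r N (z - y) < (1/2) ^ k"
      by (simp add: power_divide field_simps)
    then show ?thesis using k by simp
  qed
  then show thesis using that by blast
qed

lemma open_r_ball: "open {y. r N (y - x) < e}"
  unfolding open_iff
proof
  fix y assume "y \<in> {y. r N (y - x) < e}"
  then have "0 < e - r N (y - x)" by simp
  then obtain k where "{z. r (N + k) (z - y) < 1} \<subseteq> {z. r N (z - y) < e - r N (y - x)}"
    by (rule small_ball_subset)
  moreover have "{z. r N (z - y) < e - r N (y - x)} \<subseteq> {y. r N (y - x) < e}"
    using r_diff_triangle[of N _ x y] by (smt (verit) mem_Collect_eq subsetI)
  ultimately show "\<exists>N'. {z. r N' (z - y) < 1} \<subseteq> {y. r N (y - x) < e}" by blast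
qed

lemma closed_r_cball: "closed {y. r N (y - x) \<le> e}"
proof -
  have "open {y. e < r N (y - x)}"
    unfolding open_iff
  proof
    fix y assume "y \<in> {y. e < r N (y - x)}"
    then have "0 < r N (y - x) - e" by simp
    then obtain k where "{z. r (N + k) (z - y) < 1} \<subseteq> {z. r N (z - y) < r N (y - x) - e}"
      by (rule small_ball_subset)
    moreover have "{z. r N (z - y) < r N (y - x) - e} \<subseteq> {y. e < r N (y - x)}"
      using r_diff_triangle[of N y x] r_minus_commute[of N y] by (smt (verit) mem_Collect_eq subsetI)
    ultimately show "\<exists>N'. {z. r N' (z - y) < 1} \<subseteq> {y. e < r N (y - x)}" by blast
  qed
  moreover have "- {y. r N (y - x) \<le> e} = {y. e < r N (y - x)}" by auto
  ultimately show ?thesis by (simp add: closed_def)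
qed

lemma r_cball_Suc_subset: "{y. r (Suc N) (y - x) \<le> 1} \<subseteq> {y. r N (y - x) < 1}"
  using double_le[of N "_ - x"] by (smt (verit) mem_Collect_eq subsetI)

text \<open>By doubling, the closed unit ball of \<open>r (Suc N)\<close> lies in the open unit ball
  of \<open>r N\<close>. The lower bound \<open>m\<close> lets the Baire construction pick balls
  with strictly increasing indices.\<close>

lemma open_contains_r_cball:
  assumes "open U" "x \<in> U"
  obtains N where "m \<le> N" "{y. r N (y - x) \<le> 1} \<subseteq> U"
proof -
  obtain N where N: "{y. r N (y - x) < 1} \<subseteq> U" using assms open_iff by blast
  have "{y. r (max m (Suc N)) (y - x) \<le> 1} \<subseteq> {y. r (Suc N) (y - x) \<le> 1}"
    using r_mono[of "Suc N" "max m (Suc N)"] by (smt (verit) max.cobounded2 mem_Collect_eq subsetI)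
  then show thesis using N r_cball_Suc_subset that[of "max m (Suc N)"] by fastforce
qed

section \<open>Hausdorff property, Baire category and a countable pi-base\<close>

lemma Hausdorff_euclidean: "Hausdorff_space (euclidean :: 'e topology)"
  unfolding Hausdorff_space_def
proof (intro allI impI)
  fix x y :: 'e
  assume "x \<in> topspace euclidean \<and> y \<in> topspace euclidean \<and> x \<noteq> y"
  then have "x - y \<noteq> 0" by simp
  then obtain n where n: "r n (x - y) \<noteq> 0" using separating by blast
  let ?e = "r n (x - y) / 2"
  have pos: "0 < ?e" using n r_nonneg[of n "x - y"] by simp
  have "r n (x - y) \<le> r n (z - x) + r n (z - y)" for z
    using r_diff_triangle[of n x y z] r_minus_commute[of n x z] by simp
  then have "disjnt {z. r n (z - x) < ?e} {z. r n (z - y) < ?e}"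
    unfolding disjnt_iff by (smt (verit) field_sum_of_halves mem_Collect_eq)
  then show "\<exists>U V. openin euclidean U \<and> openin euclidean V \<and> x \<in> U \<and> y \<in> V \<and> disjnt U V"
    using pos open_r_ball[of n x ?e] open_r_ball[of n y ?e] open_openin
    by (metis (mono_tags, lifting) diff_self mem_Collect_eq r_zero)
qed

lemma compact_closed:
  fixes K :: "'e set"
  assumes "compact K" shows "closed K"
proof -
  have "closedin euclidean K"
    using assms by (intro compactin_imp_closedin[OF Hausdorff_euclidean]) simp
  then show ?thesis by simp
qed

text \<open>If no \<open>F n\<close> contained a nonempty open set, one could choose nested closed
  balls in \<open>U\<close>, the ball chosen at stage \<open>k\<close> avoiding \<open>F k\<close>.
  Their indices grow, so the centres are Cauchy, and the limit would be a point of \<open>U\<close>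
  outside every \<open>F k\<close>.\<close>

lemma baire:
  fixes F :: "nat \<Rightarrow> 'e set"
  assumes "open U" "U \<noteq> {}" and F: "\<And>n. closed (F n)" and cover: "U \<subseteq> (\<Union>n. F n)"
  shows "\<exists>n W. open W \<and> W \<noteq> {} \<and> W \<subseteq> F n"
proof (rule ccontr)
  assume "\<not> ?thesis"
  then have no: "\<not> W \<subseteq> F n" if "open W" "W \<noteq> {}" for W n using that by blast
  \<comment> \<open>A ball is encoded by its centre and the index of its seminorm; \<open>?B\<close>
    and \<open>?C\<close> are the open and the closed version.\<close>
  let ?B = "\<lambda>s::'e \<times> nat. {y. r (snd s) (y - fst s) < 1}"
  let ?C = "\<lambda>s::'e \<times> nat. {y. r (snd s) (y - fst s) \<le> 1}"
  obtain u where "u \<in> U" using assms by auto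
  obtain N0 where N0: "{y. r N0 (y - u) \<le> 1} \<subseteq> U"
    using open_contains_r_cball[OF \<open>open U\<close> \<open>u \<in> U\<close>, of 0] by blast
  have "\<exists>s'. snd s < snd s' \<and> ?C s' \<subseteq> ?B s - F k" for s k
  proof -
    have "open (?B s)" by (rule open_r_ball)
    moreover have "fst s \<in> ?B s" by simp
    ultimately obtain y where y: "y \<in> ?B s - F k" using no[of "?B s" k] by blast
    have "open (?B s - F k)" using open_r_ball F by (intro open_Diff)
    then obtain M where "Suc (snd s) \<le> M" "{z. r M (z - y) \<le> 1} \<subseteq> ?B s - F k"
      using open_contains_r_cball y by metis
    then show ?thesis by (intro exI[of _ "(y, M)"]) auto
  qed
  note step = this
  define g where "g k s = (SOME s'. snd s < snd s' \<and> ?C s' \<subseteq> ?B s - F k)" for k s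
  have g: "snd s < snd (g k s)" "?C (g k s) \<subseteq> ?B s - F k" for s k
    using someI_ex[OF step[of s k]] unfolding g_def by blast+
  define S where "S = rec_nat (u, N0) g"
  have S0: "S 0 = (u, N0)" and SS: "S (Suc k) = g k (S k)" for k
    by (simp_all add: S_def)
  have dec: "?C (S j) \<subseteq> ?C (S i)" if "i \<le> j" for i j
    using that
  proof (induction j rule: dec_induct)
    case (step j)
    have "?C (S (Suc j)) \<subseteq> ?C (S j)" using g(2)[of j "S j"] SS[of j] by (simp add: subset_iff less_imp_le)
    then show ?case using step by blast
  qed simp
  have large: "k \<le> snd (S k)" for k
  proof (induction k)
    case (Suc k)
    then show ?case using g(1)[of "S k" k] SS[of k] by simp
  qed simp
  have mem: "fst (S j) \<in> ?C (S i)" if "i \<le> j" for i j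
    using subsetD[OF dec[OF that], of "fst (S j)"] by simp
  have "\<exists>M. \<forall>i\<ge>M. \<forall>j\<ge>M. r n (fst (S i) - fst (S j)) < 1" for n
  proof (intro exI allI impI)
    \<comment> \<open>From stage \<open>n + 2\<close> on the ball index is at least
      \<open>n + 2\<close>. Two doublings then put all later centres within 1/4 of the centre at
      stage \<open>?M\<close>, hence within 1/2 of each other, in \<open>r n\<close>.\<close>
    let ?M = "n + 2"
    have small: "r n (fst (S i) - fst (S ?M)) \<le> 1/4" if "?M \<le> i" for i
    proof -
      have "r (snd (S ?M)) (fst (S i) - fst (S ?M)) \<le> 1" using mem[OF that] by simp
      then have "r ?M (fst (S i) - fst (S ?M)) \<le> 1" using r_mono[OF large[of ?M], of "fst (S i) - fst (S ?M)"] by linarith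
      then show ?thesis using power_two_r_le[of 2 n "fst (S i) - fst (S ?M)"] by simp
    qed
    fix i j assume "?M \<le> i" "?M \<le> j"
    then show "r n (fst (S i) - fst (S j)) < 1"
      using small[of i] small[of j] r_diff_triangle[of n "fst (S i)" "fst (S j)" "fst (S ?M)"]
        r_minus_commute[of n "fst (S j)" "fst (S ?M)"] by simp
  qed
  then have "\<exists>x. (\<lambda>i. fst (S i)) \<longlonglongrightarrow> x" by (rule complete)
  then obtain x where lim: "(\<lambda>i. fst (S i)) \<longlonglongrightarrow> x" by (rule exE)
  have x: "x \<in> ?C (S k)" for k
  proof (rule Lim_in_closed_set[OF closed_r_cball _ _ lim])
    show "\<forall>\<^sub>F i in sequentially. fst (S i) \<in> ?C (S k)"
      unfolding eventually_sequentially by (intro exI[of _ k] allI impI mem)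
  qed simp
  then have "x \<in> U" using x[of 0] N0 S0 by auto
  then obtain k where "x \<in> F k" using cover by blast
  then show False using x[of "Suc k"] g(2)[of k "S k"] SS[of k] by auto
qed

text \<open>The sets are the unit balls of all indices around the points of a countable dense set.
  Containment in \<open>V\<close> is all that is wanted, because hitting sets and their densities
  grow with the target.\<close>

lemma countable_pi_base:
  assumes "separable_space (euclidean :: 'e topology)"
  obtains G :: "nat \<Rightarrow> 'e set" where "\<And>n. open (G n)" "\<And>n. G n \<noteq> {}"
    "\<And>V. open V \<Longrightarrow> V \<noteq> {} \<Longrightarrow> \<exists>n. G n \<subseteq> V"
proof -
  obtain D :: "'e set" where D: "countable D" "closure D = UNIV"
    using assms unfolding separable_space_def by auto
  let ?G = "(\<lambda>(N, d). {y. r N (y - d) < 1}) ` (UNIV \<times> D)"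
  have "D \<noteq> {}" using D by auto
  have range: "range (from_nat_into ?G) = ?G"
    using D \<open>D \<noteq> {}\<close> by (intro range_from_nat_into) auto
  show thesis
  proof
    fix n
    have "from_nat_into ?G n \<in> ?G" using range by blast
    then obtain N d where eq: "from_nat_into ?G n = {y. r N (y - d) < 1}" by auto
    then show "open (from_nat_into ?G n)" using open_r_ball by simp
    have "d \<in> from_nat_into ?G n" unfolding eq by simp
    then show "from_nat_into ?G n \<noteq> {}" by blast
  next
    fix V :: "'e set" assume "open V" "V \<noteq> {}"
    then obtain v N where N: "{y. r N (y - v) < 1} \<subseteq> V" using open_iff by blast
    have "v \<in> closure D" using D by simp
    moreover have "v \<in> {y. r (Suc N) (y - v) < 1}" by simp
    ultimately obtain d where d: "d \<in> D" "r (Suc N) (d - v) < 1"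
      using open_r_ball[of "Suc N" v 1] open_Int_closure_eq_empty by blast
    \<comment> \<open>Both \<open>y\<close> and \<open>v\<close> are within 1 of \<open>d\<close> in
      \<open>r (Suc N)\<close>, so they are within 2 of each other there and within 1 in
      \<open>r N\<close>.\<close>
    have "r N (y - v) < 1" if "r (Suc N) (y - d) < 1" for y
      using that d(2) double_le[of N "y - v"] r_diff_triangle[of "Suc N" y v d] by simp
    then have "{y. r (Suc N) (y - d) < 1} \<subseteq> V" using N by blast
    moreover have "{y. r (Suc N) (y - d) < 1} \<in> range (from_nat_into ?G)"
      unfolding range using d(1) by force
    then obtain n where "{y. r (Suc N) (y - d) < 1} = from_nat_into ?G n" by (rule rangeE)
    ultimately show "\<exists>n. from_nat_into ?G n \<subseteq> V" by auto
  qed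
qed

text \<open>
  A totally bounded ball \<open>U\<close> satisfies \<open>U \<subseteq> D + U/2\<close> for a finite set \<open>D\<close>; iterating this expands
  a vector as a series \<open>\<Sum>k. d\<^sub>k / 2^k\<close> with terms in \<open>D\<close>, and collecting equal \<open>d\<^sub>k\<close> turns the
  series into a finite linear combination.
\<close>

lemma finite_dimensional_if_compact_neighbourhood:
  fixes K W :: "'e set"
  assumes "compact K" "open W" "W \<noteq> {}" "W \<subseteq> K"
  shows "\<not> infinite_dimensional smul"
proof -
  obtain w where "w \<in> W" using \<open>W \<noteq> {}\<close> by blast
  then obtain N where "{y. r N (y - w) < 1} \<subseteq> W" using \<open>open W\<close> open_iff by blast
  then have N: "{y. r N (y - w) < 1} \<subseteq> K" using \<open>W \<subseteq> K\<close> by blast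
  \<comment> \<open>The remainders of the series are controlled in \<open>r N\<close> only, whereas
    the limit must be identified in every \<open>r n\<close>; compactness of \<open>K\<close>
    provides the missing bounds.\<close>
  have bounded: "\<exists>C. \<forall>y. r N y < 1 \<longrightarrow> r n y \<le> C" for n
  proof -
    have "K \<subseteq> (\<Union>m\<in>UNIV. {y. r n (y - w) < real m})"
      by (auto intro: reals_Archimedean2)
    then obtain J where J: "finite J" "K \<subseteq> (\<Union>m\<in>J. {y. r n (y - w) < real m})"
      using compactE_image[OF \<open>compact K\<close>, of UNIV "\<lambda>m. {y. r n (y - w) < real m}"] open_r_ball
      by metis
    have "r n y \<le> real (\<Sum>J)" if "r N y < 1" for y
    proof -
      have "w + y \<in> K" using N that by auto
      then obtain m where "m \<in> J" "r n y < real m" using J by auto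
      moreover have "m \<le> \<Sum>J" using \<open>m \<in> J\<close> J(1) member_le_sum[of m J "\<lambda>i. i"] by simp
      ultimately show ?thesis by linarith
    qed
    then show ?thesis by (intro exI[of _ "real (\<Sum>J)"]) blast
  qed
  have "b \<in> {y. r N (y - b) < 1/2}" for b by simp
  then have "K \<subseteq> (\<Union>b\<in>K. {y. r N (y - b) < 1/2})" by blast
  then obtain B where B: "finite B" "K \<subseteq> (\<Union>b\<in>B. {y. r N (y - b) < 1/2})"
    using compactE_image[OF \<open>compact K\<close>, of K "\<lambda>b. {y. r N (y - b) < 1/2}"] open_r_ball
    by metis
  \<comment> \<open>Recentring at \<open>w\<close> turns the finite cover of \<open>K\<close> by
    balls of radius 1/2 into a 1/2-net of the unit ball around 0.\<close>
  define D where "D = (\<lambda>b. b - w) ` B"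
  have finD: "finite D" using B by (simp add: D_def)
  have "\<exists>d\<in>D. r N (y - d) < 1/2" if "r N y < 1" for y
  proof -
    have "w + y \<in> K" using N that by auto
    then obtain b where "b \<in> B" "r N (w + y - b) < 1/2" using B by blast
    then show ?thesis unfolding D_def by (auto simp: algebra_simps)
  qed
  then obtain d where d: "\<And>y. r N y < 1 \<Longrightarrow> d y \<in> D \<and> r N (y - d y) < 1/2" by metis
  have ball_span: "y \<in> span D" if y: "r N y < 1" for y
  proof -
    \<comment> \<open>\<open>z k\<close> is the \<open>k\<close>-th remainder magnified by
      \<open>2 ^ k\<close>. Subtracting its approximant leaves less than 1/2, so the doubled
      difference is again in the unit ball.\<close>
    define z where "z = rec_nat y (\<lambda>k z. smul (of_real 2) (z - d z))"
    have z0: "z 0 = y" and zS: "z (Suc k) = smul (of_real 2) (z k - d (z k))" for k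
      by (simp_all add: z_def)
    have zN: "r N (z k) < 1" for k
    proof (induction k)
      case (Suc k)
      then show ?case using d[of "z k"] unfolding zS r_scale by simp
    qed (simp add: z0 y)
    \<comment> \<open>\<open>a b k\<close> is the weight of \<open>b\<close> at stage
      \<open>k\<close>; summing over \<open>k\<close> collects all occurrences of \<open>b\<close>.
      These weights are real, so their series converge without appeal to completeness of
      \<open>'k\<close>.\<close>
    define a where "a b k = (if d (z k) = b then (1/2) ^ k else 0 :: real)" for b k
    have a_summable: "summable (a b)" for b
      by (rule summable_comparison_test[OF _ summable_geometric[of "1/2 :: real"]])
        (auto simp: a_def)
    define P where "P k = (\<Sum>b\<in>D. smul (of_real (\<Sum>i<k. a b i)) b)" for k
    define L where "L = (\<Sum>b\<in>D. smul (of_real (suminf (a b))) b)"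
    have P_Suc: "P (Suc k) = P k + smul (of_real ((1/2) ^ k)) (d (z k))" for k
    proof -
      have "smul (of_real (a b k)) b =
          (if d (z k) = b then smul (of_real ((1/2) ^ k)) (d (z k)) else 0)" for b
        by (auto simp: a_def)
      then have "(\<Sum>b\<in>D. smul (of_real (a b k)) b) = smul (of_real ((1/2) ^ k)) (d (z k))"
        using finD d[OF zN[of k]] by (simp add: sum.delta)
      then show ?thesis
        by (simp add: P_def scale_left_distrib sum.distrib)
    qed
    have expand: "y - P k = smul (of_real ((1/2) ^ k)) (z k)" for k
    proof (induction k)
      case 0
      then show ?case by (simp add: P_def z0)
    next
      case (Suc k)
      have "smul (of_real ((1/2) ^ Suc k)) (z (Suc k)) =
          smul (of_real ((1/2) ^ Suc k) * of_real 2) (z k - d (z k))"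
        unfolding zS by simp
      also have "(of_real ((1/2) ^ Suc k) * of_real 2 :: 'k) = of_real ((1/2) ^ k)"
        unfolding of_real_mult[symmetric] by simp
      finally show ?case using Suc P_Suc[of k] by (simp add: scale_right_diff_distrib algebra_simps)
    qed
    have "r n (y - L) = 0" for n
    proof -
      obtain C where C: "\<And>y. r N y < 1 \<Longrightarrow> r n y \<le> C" using bounded by blast
      \<comment> \<open>The distance from \<open>y\<close> to \<open>L\<close> is split at
        \<open>P k\<close>: the first term bounds the remainder of the expansion, the second the
        tails of the coefficient series.\<close>
      let ?h = "\<lambda>k. (1/2) ^ k * C + (\<Sum>b\<in>D. \<bar>(\<Sum>i<k. a b i) - suminf (a b)\<bar> * r n b)"
      have le: "r n (y - L) \<le> ?h k" for k
      proof -
        have "P k - L = (\<Sum>b\<in>D. smul (of_real ((\<Sum>i<k. a b i) - suminf (a b))) b)"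
          unfolding P_def L_def sum_subtractf[symmetric]
          by (simp only: of_real_diff scale_left_diff_distrib)
        then have "r n (P k - L) \<le> (\<Sum>b\<in>D. \<bar>(\<Sum>i<k. a b i) - suminf (a b)\<bar> * r n b)"
          using r_sum[OF finD, of n "\<lambda>b. smul (of_real ((\<Sum>i<k. a b i) - suminf (a b))) b"]
          by (simp only: r_scale norm_of_real)
        moreover have "r n (y - P k) \<le> (1/2) ^ k * C"
          unfolding expand r_scale using C[OF zN[of k]] by (simp add: norm_power)
        ultimately show ?thesis using r_diff_triangle[of n y L "P k"] by linarith
      qed
      have "(\<lambda>k. (\<Sum>i<k. a b i) - suminf (a b)) \<longlonglongrightarrow> 0" for b
        using summable_LIMSEQ[OF a_summable[of b]] LIM_zero by blast
      then have "?h \<longlonglongrightarrow> 0 * C + (\<Sum>b\<in>D. \<bar>0\<bar> * r n b)"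
        by (intro tendsto_intros LIMSEQ_power_zero) auto
      then have "r n (y - L) \<le> 0"
        using le by (intro LIMSEQ_le_const[of ?h]) auto
      then show ?thesis using r_nonneg[of n "y - L"] by simp
    qed
    then have "y = L" using separating[of "y - L"] by simp
    then show ?thesis unfolding L_def by (simp add: span_sum span_scale span_base)
  qed
  have "x \<in> span D" for x
  proof -
    obtain k where k: "r N x < 2 ^ k" using real_arch_pow[of 2 "r N x"] by auto
    have "r N (smul (of_real ((1/2) ^ k)) x) < 1"
      unfolding r_scale using k by (simp add: norm_power norm_divide power_divide)
    then have "smul (of_real (2 ^ k)) (smul (of_real ((1/2) ^ k)) x) \<in> span D"
      using ball_span span_scale by blast
    moreover have "(of_real (2 ^ k) * of_real ((1/2) ^ k) :: 'k) = 1"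
      unfolding of_real_mult[symmetric] by (simp add: power_mult_distrib[symmetric])
    ultimately show ?thesis by simp
  qed
  then show ?thesis using finD unfolding infinite_dimensional_def by blast
qed

end

section \<open>From generating seminorms to graded ones\<close>

lemma (in frechet_space) graded_frechet_space:
  obtains r where "graded_frechet_space smul r"
proof -
  obtain p :: "nat \<Rightarrow> 'e \<Rightarrow> real" where P:
    "(\<forall>n. seminorm smul (p n)) \<and>
       (\<forall>x. (\<forall>n. p n x = 0) \<longrightarrow> x = 0) \<and>
       (\<forall>U. open U \<longleftrightarrow>
          (\<forall>x\<in>U. \<exists>N. \<exists>\<epsilon>>0. {y. \<forall>n\<le>N. p n (y - x) < \<epsilon>} \<subseteq> U)) \<and>
       (\<forall>X :: nat \<Rightarrow> 'e.
          (\<forall>n. \<forall>\<epsilon>>0. \<exists>M. \<forall>i\<ge>M. \<forall>j\<ge>M. p n (X i - X j) < \<epsilon>) \<longrightarrow> (\<exists>x. X \<longlonglongrightarrow> x))"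
    using generating_seminorms by (rule exE)
  have p: "seminorm smul (p n)" for n
    by (rule spec[OF conjunct1[OF P]])
  have sep: "x = 0" if "\<And>n. p n x = 0" for x
    using mp[OF spec[OF conjunct1[OF conjunct2[OF P]]]] that by simp
  have op: "open U \<longleftrightarrow>
      (\<forall>x\<in>U. \<exists>N. \<exists>\<epsilon>>0. {y. \<forall>n\<le>N. p n (y - x) < \<epsilon>} \<subseteq> U)" for U
    by (rule spec[OF conjunct1[OF conjunct2[OF conjunct2[OF P]]]])
  have compl: "\<exists>x. X \<longlonglongrightarrow> x"
    if "\<And>n \<epsilon>. \<epsilon> > 0 \<Longrightarrow> \<exists>M. \<forall>i\<ge>M. \<forall>j\<ge>M. p n (X i - X j) < \<epsilon>" for X
    using mp[OF spec[OF conjunct2[OF conjunct2[OF conjunct2[OF P]]], of X]] that by simp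
  have tri: "p n (x + y) \<le> p n x + p n y" and sc: "p n (smul c x) = norm c * p n x" for n x y c
    using p unfolding seminorm_def by blast+
  have nonneg: "0 \<le> p n x" for n x
    using tri[of n x "- x"] sc[of n "-1" x] sc[of n 0 0] by simp
  \<comment> \<open>The sum lets one seminorm control finitely many, and the factor
    \<open>2 ^ N\<close> provides the doubling.\<close>
  define r where "r N x = 2 ^ N * (\<Sum>n\<le>N. p n x)" for N x
  have rp: "2 ^ N * p n x \<le> r N x" if "n \<le> N" for n N x
    unfolding r_def using that nonneg
    by (intro mult_left_mono member_le_sum) auto
  have "graded_frechet_space smul r"
  proof
    show "seminorm smul (r n)" for n
      unfolding seminorm_def r_def sc sum_distrib_left[symmetric]
      using tri by (auto simp: distrib_left[symmetric] sum.distrib[symmetric] intro!: sum_mono)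
    show "2 * r n x \<le> r (Suc n) x" for n x
      unfolding r_def using nonneg by (simp add: distrib_left)
    show "x = 0" if "\<And>n. r n x = 0" for x
      using sep[of x] rp[of _ _ x] that nonneg[of _ x]
      by (metis antisym mult_le_0_iff order_refl not_less zero_less_numeral zero_less_power)
    show "open U \<longleftrightarrow> (\<forall>x\<in>U. \<exists>N. {y. r N (y - x) < 1} \<subseteq> U)" for U
    proof -
      have "(\<exists>N. {y. r N (y - x) < 1} \<subseteq> U) \<longleftrightarrow>
          (\<exists>N. \<exists>\<epsilon>>0. {y. \<forall>n\<le>N. p n (y - x) < \<epsilon>} \<subseteq> U)" for x
      proof
        assume "\<exists>N. {y. r N (y - x) < 1} \<subseteq> U"
        then obtain N where N: "{y. r N (y - x) < 1} \<subseteq> U" by blast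
        \<comment> \<open>The \<open>Suc N\<close> summands, each below \<open>?e\<close>, add up to
          less than \<open>1 / 2 ^ N\<close>, which cancels the weight in
          \<open>r N\<close>.\<close>
        let ?e = "1 / (2 ^ N * real (Suc N))"
        have "r N (y - x) < 1" if "\<forall>n\<le>N. p n (y - x) < ?e" for y
        proof -
          have "(\<Sum>n\<le>N. p n (y - x)) < (\<Sum>n\<le>N. ?e)"
            using that by (intro sum_strict_mono) auto
          also have "\<dots> = 1 / 2 ^ N" by simp
          finally show ?thesis by (simp add: r_def field_simps)
        qed
        then have "{y. \<forall>n\<le>N. p n (y - x) < ?e} \<subseteq> U" using N by blast
        moreover have "0 < ?e" by simp
        ultimately show "\<exists>N. \<exists>\<epsilon>>0. {y. \<forall>n\<le>N. p n (y - x) < \<epsilon>} \<subseteq> U" by blast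
      next
        assume "\<exists>N. \<exists>\<epsilon>>0. {y. \<forall>n\<le>N. p n (y - x) < \<epsilon>} \<subseteq> U"
        then obtain N e where N: "0 < e" "{y. \<forall>n\<le>N. p n (y - x) < e} \<subseteq> U" by blast
        obtain k where k: "(1/2) ^ k < e" using real_arch_pow_inv[OF N(1), of "1/2"] by auto
        have "p n (y - x) < e" if "r (N + k) (y - x) < 1" "n \<le> N" for y n
        proof -
          have "2 ^ k * p n (y - x) \<le> 2 ^ (N + k) * p n (y - x)"
            using nonneg by (intro mult_right_mono power_increasing) auto
          then have "2 ^ k * p n (y - x) < 1"
            using rp[of n "N + k" "y - x"] that by linarith
          then show ?thesis using k by (simp add: power_divide field_simps)
              (smt (verit) mult.commute mult_less_cancel_left_pos zero_less_power)
        qed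
        then have "{y. r (N + k) (y - x) < 1} \<subseteq> U" using N by blast
        then show "\<exists>N. {y. r N (y - x) < 1} \<subseteq> U" by blast
      qed
      then show ?thesis unfolding op by simp
    qed
    show "\<exists>x. X \<longlonglongrightarrow> x" if X: "\<And>n. \<exists>M. \<forall>i\<ge>M. \<forall>j\<ge>M. r n (X i - X j) < 1" for X
    proof (rule compl)
      fix n and e :: real assume "0 < e"
      obtain k where k: "(1/2) ^ k < e" using real_arch_pow_inv[OF \<open>0 < e\<close>, of "1/2"] by auto
      obtain M where M: "\<And>i j. i \<ge> M \<Longrightarrow> j \<ge> M \<Longrightarrow> r (n + k) (X i - X j) < 1" using X by blast
      have "p n (X i - X j) < e" if "i \<ge> M" "j \<ge> M" for i j
      proof -
        have "2 ^ k * p n (X i - X j) \<le> 2 ^ (n + k) * p n (X i - X j)"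
          using nonneg by (intro mult_right_mono power_increasing) auto
        then have "2 ^ k * p n (X i - X j) < 1"
          using rp[of n "n + k" "X i - X j"] M[OF that] by linarith
        then show ?thesis using k by (simp add: power_divide field_simps)
            (smt (verit) mult.commute mult_less_cancel_left_pos zero_less_power)
      qed
      then show "\<exists>M. \<forall>i\<ge>M. \<forall>j\<ge>M. p n (X i - X j) < e" by blast
    qed
  qed
  then show thesis using that by blast
qed


section \<open>Index sets\<close>

text \<open>Inequalities between coordinates make closedness and stability under addition easy. In
  polar form the second one says \<open>sin (\<bar>\<theta>\<bar> - \<alpha>) \<le> 0\<close>; the
  product form avoids dividing by \<open>cos \<alpha>\<close>, which vanishes at \<alpha> = pi /
  2.\<close>

lemma sector_eq:
  assumes "0 < \<alpha>" "\<alpha> \<le> pi / 2"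
  shows "sector \<alpha> = {z. 0 \<le> Re z \<and> \<bar>Im z\<bar> * cos \<alpha> \<le> Re z * sin \<alpha>}"
proof (intro equalityI subsetI)
  fix z assume "z \<in> sector \<alpha>"
  then obtain r \<theta> where z: "z = complex_of_real r * cis \<theta>" and r: "0 \<le> r" and \<theta>: "- \<alpha> \<le> \<theta>" "\<theta> \<le> \<alpha>"
    unfolding sector_def by blast
  have "0 \<le> cos \<theta>" using \<theta> assms by (intro cos_ge_zero) auto
  have "\<bar>sin \<theta>\<bar> = sin \<bar>\<theta>\<bar>"
  proof (cases "0 \<le> \<theta>")
    case True
    then show ?thesis using sin_ge_zero[of \<theta>] \<theta> assms pi_gt_zero by simp
  next
    case False
    then show ?thesis using sin_ge_zero[of "- \<theta>"] \<theta> assms pi_gt_zero by simp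
  qed
  moreover have "0 \<le> sin (\<alpha> - \<bar>\<theta>\<bar>)"
    using \<theta> assms pi_gt_zero by (intro sin_ge_zero) auto
  ultimately have "\<bar>sin \<theta>\<bar> * cos \<alpha> \<le> cos \<theta> * sin \<alpha>"
    by (simp add: sin_diff mult.commute)
  from mult_left_mono[OF this r] \<open>0 \<le> cos \<theta>\<close> r
  show "z \<in> {z. 0 \<le> Re z \<and> \<bar>Im z\<bar> * cos \<alpha> \<le> Re z * sin \<alpha>}"
    by (simp add: z abs_mult mult.assoc)
next
  fix z assume z: "z \<in> {z. 0 \<le> Re z \<and> \<bar>Im z\<bar> * cos \<alpha> \<le> Re z * sin \<alpha>}"
  show "z \<in> sector \<alpha>"
  proof (cases "z = 0")
    case True
    then show ?thesis using assms unfolding sector_def by force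
  next
    case False
    then obtain \<rho> \<theta> where polar: "z = complex_of_real \<rho> * cis \<theta>" and \<rho>: "0 < \<rho>"
      and \<theta>: "- pi < \<theta>" "\<theta> \<le> pi"
      using rcis_cmod_Arg[of z] Arg_bounded[of z] unfolding rcis_def
      by (metis zero_less_norm_iff)
    have Re: "Re z = \<rho> * cos \<theta>" and Im: "Im z = \<rho> * sin \<theta>" by (simp_all add: polar)
    have cos: "0 \<le> cos \<theta>" using z \<rho> by (simp add: Re zero_le_mult_iff)
    have le: "\<bar>\<theta>\<bar> \<le> pi / 2"
    proof (rule ccontr)
      assume "\<not> ?thesis"
      then have "cos \<bar>\<theta>\<bar> < cos (pi / 2)"
        using \<theta> by (intro cos_monotone_0_pi) auto
      then show False using cos by simp
    qed
    have "\<rho> * (\<bar>sin \<theta>\<bar> * cos \<alpha>) \<le> \<rho> * (cos \<theta> * sin \<alpha>)"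
      using z \<rho> by (simp add: Re Im abs_mult mult.assoc)
    then have "\<bar>sin \<theta>\<bar> * cos \<alpha> \<le> cos \<theta> * sin \<alpha>" using \<rho> by simp
    moreover have "sin \<bar>\<theta>\<bar> \<le> \<bar>sin \<theta>\<bar>" by (simp add: abs_if)
    moreover have "0 \<le> cos \<alpha>" using assms by (intro cos_ge_zero) auto
    ultimately have "sin \<bar>\<theta>\<bar> * cos \<alpha> \<le> cos \<theta> * sin \<alpha>"
      by (meson mult_right_mono order_trans)
    then have "sin (\<bar>\<theta>\<bar> - \<alpha>) \<le> 0" by (simp add: sin_diff)
    moreover have "\<bar>\<theta>\<bar> - \<alpha> < pi" using le assms pi_gt_zero by linarith
    ultimately have "\<bar>\<theta>\<bar> \<le> \<alpha>" using sin_gt_zero[of "\<bar>\<theta>\<bar> - \<alpha>"] by linarith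
    then have "- \<alpha> \<le> \<theta>" "\<theta> \<le> \<alpha>" by auto
    then show ?thesis using polar less_imp_le[OF \<rho>] unfolding sector_def by blast
  qed
qed

lemma index_sets_cases [consumes 1]:
  assumes "\<Delta> \<in> index_sets"
  obtains (half_line) "\<Delta> = \<real>\<^sub>\<ge>\<^sub>0" | (line) "\<Delta> = \<real>" | (plane) "\<Delta> = UNIV"
    | (sector) \<alpha> where "0 < \<alpha>" "\<alpha> \<le> pi / 2" "\<Delta> = sector \<alpha>"
  using assms unfolding index_sets_def by auto

lemma closed_index_set:
  assumes "\<Delta> \<in> index_sets" shows "closed \<Delta>"
  using assms
proof (cases rule: index_sets_cases)
  case (sector \<alpha>)
  show ?thesis unfolding sector(3) sector_eq[OF sector(1,2)]
    by (intro closed_Collect_conj closed_Collect_le continuous_intros)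
qed (simp_all only: closed_nonneg_Reals_complex closed_complex_Reals closed_UNIV)

lemma zero_in_index_set: "\<Delta> \<in> index_sets \<Longrightarrow> 0 \<in> \<Delta>"
  by (cases rule: index_sets_cases) (auto simp: sector_eq)

lemma add_in_index_set:
  assumes "\<Delta> \<in> index_sets" and st: "s \<in> \<Delta>" "t \<in> \<Delta>"
  shows "s + t \<in> \<Delta>"
  using assms(1)
proof (cases rule: index_sets_cases)
  case (sector \<alpha>)
  note st
  moreover have "\<bar>Im s + Im t\<bar> * cos \<alpha> \<le> (\<bar>Im s\<bar> + \<bar>Im t\<bar>) * cos \<alpha>"
    using sector by (intro mult_right_mono cos_ge_zero abs_triangle_ineq) auto
  ultimately show ?thesis
    unfolding sector(3) sector_eq[OF sector(1,2)] by (auto simp: algebra_simps)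
next
  case half_line
  then show ?thesis using st nonneg_Reals_add_I by blast
next
  case line
  then show ?thesis using st Reals_add by blast
qed simp

section \<open>Lebesgue measure of pieces of an index set\<close>

lemma of_real_vimage_borel:
  "A \<in> sets borel \<Longrightarrow> complex_of_real -` A \<in> sets borel"
  using measurable_sets[of complex_of_real borel borel A]
  by (simp add: borel_measurable_continuous_onI continuous_on_of_real)

text \<open>A nonmeasurable set has \<open>emeasure\<close> 0, so the inequality also covers
  nonmeasurable \<open>A\<close>.\<close>

lemma index_measure_mono:
  assumes "A \<subseteq> B" "B \<in> sets borel"
  shows "index_measure \<Delta> A \<le> index_measure \<Delta> B"
proof -
  have "emeasure lebesgue A \<le> emeasure lebesgue B"
    using assms by (intro emeasure_mono sets_completionI_sets) auto
  moreover have "emeasure lebesgue (complex_of_real -` A) \<le> emeasure lebesgue (complex_of_real -` B)"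
    using assms of_real_vimage_borel[OF assms(2)]
    by (intro emeasure_mono sets_completionI_sets vimage_mono) auto
  ultimately show ?thesis
    unfolding index_measure_def by (simp only: split: if_split) blast
qed

lemma index_measure_Un:
  assumes "A \<in> sets borel" "B \<in> sets borel" "A \<inter> B = {}"
  shows "index_measure \<Delta> (A \<union> B) = index_measure \<Delta> A + index_measure \<Delta> B"
proof -
  have "complex_of_real -` A \<inter> complex_of_real -` B = {}" using assms(3) by blast
  then show ?thesis
    using assms of_real_vimage_borel[OF assms(1)] of_real_vimage_borel[OF assms(2)]
    unfolding index_measure_def by (auto simp: plus_emeasure)
qed

text \<open>The ball contains a point vertically above its centre, so \<open>\<Delta>\<close> is not
  contained in the real line and \<open>index_measure\<close> is area.\<close>

lemma translated_ball_index_measure: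
  assumes "0 < \<rho>" "cball z \<rho> \<subseteq> \<Delta>"
  shows "index_measure \<Delta> ((+) t ` cball z \<rho>) = ennreal (pi * \<rho>\<^sup>2)"
proof -
  have "z + complex_of_real \<rho> * \<i> \<in> cball z \<rho>" "z \<in> cball z \<rho>"
    using assms(1) by (auto simp: dist_norm norm_mult)
  then have "z + complex_of_real \<rho> * \<i> \<in> \<Delta>" "z \<in> \<Delta>" using assms(2) by blast+
  then have "Im (z + complex_of_real \<rho> * \<i>) = 0 \<and> Im z = 0" if "\<Delta> \<subseteq> \<real>"
    using that unfolding complex_is_Real_iff[symmetric] by blast
  then have "\<not> \<Delta> \<subseteq> \<real>" using assms(1) by auto
  moreover have "(+) t ` cball z \<rho> = cball (t + z) \<rho>"
    by (rule cball_translation[symmetric])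
  ultimately show ?thesis
    using assms(1) emeasure_cball[of \<rho> "t + z"]
    by (simp add: index_measure_def unit_ball_vol_2 DIM_complex)
qed

text \<open>\<open>S\<close> is a segment or a disc inside \<open>\<Delta>\<^sub>\<delta>\<close>, a
  shape whose translates all have the same explicit measure. Its translates are the pieces to be
  packed into a hitting set.\<close>

lemma index_set_piece:
  assumes "\<Delta> \<in> index_sets" "0 < \<delta>"
  obtains S c where "closed S" "S \<subseteq> index_upto \<Delta> \<delta>" "0 < c"
    "\<And>t. t \<in> \<Delta> \<Longrightarrow> index_measure \<Delta> ((+) t ` S) = ennreal c"
proof -
  have real_case: thesis if real: "\<Delta> \<subseteq> \<real>" "\<real>\<^sub>\<ge>\<^sub>0 \<subseteq> \<Delta>"
  proof
    show "closed (complex_of_real ` {0..\<delta>})"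
      by (intro compact_imp_closed compact_continuous_image continuous_on_of_real) auto
    show "complex_of_real ` {0..\<delta>} \<subseteq> index_upto \<Delta> \<delta>"
      using real(2) by (auto simp: index_upto_def)
    show "0 < \<delta>" by fact
    fix t assume "t \<in> \<Delta>"
    then obtain u where u: "t = complex_of_real u" using real(1) by (auto elim: Reals_cases)
    have "complex_of_real -` (+) t ` complex_of_real ` {0..\<delta>} = {u..u + \<delta>}"
    proof (intro equalityI subsetI)
      fix v assume "v \<in> {u..u + \<delta>}"
      then have "v - u \<in> {0..\<delta>}" "complex_of_real v = t + complex_of_real (v - u)"
        by (auto simp: u)
      then show "v \<in> complex_of_real -` (+) t ` complex_of_real ` {0..\<delta>}" by blast
    next
      fix v assume "v \<in> complex_of_real -` (+) t ` complex_of_real ` {0..\<delta>}"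
      then obtain w where "w \<in> {0..\<delta>}" "complex_of_real v = complex_of_real u + complex_of_real w"
        by (auto simp: u)
      then show "v \<in> {u..u + \<delta>}" by (simp flip: of_real_add)
    qed
    then show "index_measure \<Delta> ((+) t ` complex_of_real ` {0..\<delta>}) = ennreal \<delta>"
      using real assms by (simp add: index_measure_def)
  qed
  have ball_case: thesis if "0 < \<rho>" "cball z \<rho> \<subseteq> index_upto \<Delta> \<delta>" for z \<rho>
  proof
    show "closed (cball z \<rho>)" by simp
    show "cball z \<rho> \<subseteq> index_upto \<Delta> \<delta>" by fact
    show "0 < pi * \<rho>\<^sup>2" using that by simp
    show "index_measure \<Delta> ((+) t ` cball z \<rho>) = ennreal (pi * \<rho>\<^sup>2)" for t
      using that by (intro translated_ball_index_measure) (auto simp: index_upto_def)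
  qed
  from assms(1) show thesis
  proof (cases rule: index_sets_cases)
    case half_line
    then show ?thesis using real_case nonneg_Reals_subset_Reals by simp
  next
    case line
    then show ?thesis using real_case nonneg_Reals_subset_Reals by simp
  next
    case plane
    then show ?thesis using ball_case[of \<delta> 0] assms(2) by (simp add: index_upto_def subset_iff)
  next
    case (sector \<alpha>)
    have sin: "0 < sin \<alpha>" "sin \<alpha> \<le> 1" and cos: "0 \<le> cos \<alpha>" "cos \<alpha> \<le> 1"
      using sector assms pi_gt_zero by (auto intro!: sin_gt_zero cos_ge_zero)
    \<comment> \<open>On this disc \<open>Re w\<close> is at least \<open>\<delta> / 4\<close> and
      \<open>\<bar>Im w\<bar>\<close> at most \<open>\<delta> * sin \<alpha> / 4\<close>, which
      gives the sector inequality since \<open>cos \<alpha> \<le> 1\<close>.\<close>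
    let ?\<rho> = "\<delta> * sin \<alpha> / 4" and ?z = "complex_of_real (\<delta> / 2)"
    have \<rho>: "0 < ?\<rho>" "?\<rho> \<le> \<delta> / 4" using sin assms by auto
    have "w \<in> index_upto \<Delta> \<delta>" if "w \<in> cball ?z ?\<rho>" for w
    proof -
      have dist: "norm (w - ?z) \<le> ?\<rho>" using that by (simp add: dist_norm norm_minus_commute)
      have "norm w \<le> norm ?z + norm (w - ?z)" by (rule norm_triangle_sub)
      then have "norm w \<le> \<delta>" using dist \<rho> assms(2) norm_of_real[of "\<delta> / 2", where ?'a = complex]
        by linarith
      have Im: "\<bar>Im w\<bar> \<le> ?\<rho>" using abs_Im_le_cmod[of "w - ?z"] dist by simp
      have Re: "\<delta> / 4 \<le> Re w" using abs_Re_le_cmod[of "w - ?z"] dist \<rho> by simp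
      have "\<bar>Im w\<bar> * cos \<alpha> \<le> ?\<rho> * 1" using Im cos by (intro mult_mono) auto
      also have "\<dots> \<le> Re w * sin \<alpha>" using mult_right_mono[OF Re, of "sin \<alpha>"] sin by simp
      finally show ?thesis
        using \<open>norm w \<le> \<delta>\<close> Re assms
        unfolding index_upto_def sector(3) sector_eq[OF sector(1,2)] by simp
    qed
    then show ?thesis using ball_case[OF \<rho>(1)] by blast
  qed
qed

lemma closed_index_upto: "\<Delta> \<in> index_sets \<Longrightarrow> closed (index_upto \<Delta> s)"
  using closed_Int[OF closed_index_set closed_cball[of 0 s]]
  by (simp add: index_upto_def Int_def)

lemma compact_index_upto: "\<Delta> \<in> index_sets \<Longrightarrow> compact (index_upto \<Delta> s)"
  using compact_Int_closed[OF compact_cball[of 0 s] closed_index_set]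
  by (simp add: index_upto_def Int_def conj_commute)

section \<open>Lower densities and the choice of \<open>f\<close>\<close>

lemma lower_density_mono:
  assumes "\<Delta> \<in> index_sets" "A \<subseteq> B" "B \<in> sets borel"
  shows "lower_density \<Delta> f A \<le> lower_density \<Delta> f B"
  unfolding lower_density_def
  using assms closed_index_upto[OF assms(1)]
  by (intro Liminf_mono always_eventually allI divide_right_mono_ennreal index_measure_mono) auto

text \<open>
  The values of \<open>f\<close> dominate, at the integer \<open>m = \<lceil>t\<rceil>\<close>, thresholds beyond which
  \<open>A 0, \<dots>, A m\<close> have measure at least \<open>(m + 1)\<^sup>2\<close>; dividing by \<open>t \<le> m + 1\<close> leaves a divergent quantity.
\<close>

lemma infinite_lower_densities:
  fixes A :: "nat \<Rightarrow> complex set"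
  assumes \<Delta>: "\<Delta> \<in> index_sets" and A: "\<And>k. A k \<in> sets borel"
    and large: "\<And>k C. \<exists>s. ennreal C \<le> index_measure \<Delta> (A k \<inter> index_upto \<Delta> s)"
  obtains f where "f \<in> {0..} \<rightarrow> {1..}" "strict_mono_on {0..} f"
    "\<And>k. lower_density \<Delta> f (A k) = \<infinity>"
proof -
  have "\<forall>k m. \<exists>s. ennreal ((real m + 1)\<^sup>2) \<le> index_measure \<Delta> (A k \<inter> index_upto \<Delta> s)"
    using large by blast
  then obtain s where s: "\<And>k m. ennreal ((real m + 1)\<^sup>2) \<le> index_measure \<Delta> (A k \<inter> index_upto \<Delta> (s k m))"
    by metis
  \<comment> \<open>Summing absolute values over all \<open>k \<le> m \<le> n\<close> makes
    \<open>g\<close> nondecreasing and at least every threshold \<open>s k m\<close>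
    involved.\<close>
  define g where "g n = (\<Sum>m\<le>n. \<Sum>k\<le>m. \<bar>s k m\<bar>)" for n
  \<comment> \<open>The summand 1 keeps the values at least 1, and the summand \<open>t\<close>
    makes the growth strict.\<close>
  define f where "f t = 1 + t + g (nat \<lceil>t\<rceil>)" for t :: real
  have g_nonneg: "0 \<le> g n" for n unfolding g_def by (intro sum_nonneg) auto
  have g_mono: "g m \<le> g n" if "m \<le> n" for m n
    unfolding g_def using that by (intro sum_mono2 sum_nonneg) auto
  have s_le: "s k n \<le> g n" if "k \<le> n" for k n
  proof -
    have "\<bar>s k n\<bar> \<le> (\<Sum>k\<le>n. \<bar>s k n\<bar>)"
      using that by (intro member_le_sum[of k "{..n}" "\<lambda>k. \<bar>s k n\<bar>"]) auto
    also have "\<dots> \<le> g n"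
      unfolding g_def by (intro member_le_sum[of n "{..n}" "\<lambda>m. \<Sum>k\<le>m. \<bar>s k m\<bar>"]) (auto intro: sum_nonneg)
    finally show ?thesis by simp
  qed
  show thesis
  proof
    show "f \<in> {0..} \<rightarrow> {1..}" using g_nonneg by (auto simp: f_def add_nonneg_nonneg)
    show "strict_mono_on {0..} f"
    proof (rule strict_mono_onI)
      fix t u :: real assume "t < u"
      then have "nat \<lceil>t\<rceil> \<le> nat \<lceil>u\<rceil>" by (intro nat_mono ceiling_mono) simp
      then show "f t < f u" using g_mono \<open>t < u\<close> by (simp add: f_def add_less_le_mono)
    qed
    fix k
    \<comment> \<open>The condition on \<open>t\<close> forces \<open>k \<le> ?m\<close>, so that
      \<open>s k ?m\<close> is among the thresholds dominated by \<open>g ?m\<close>.\<close>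
    have bound: "ennreal t \<le> index_measure \<Delta> (A k \<inter> index_upto \<Delta> (f t)) / ennreal t"
      if t: "t \<ge> real k + 1" for t
    proof -
      let ?m = "nat \<lceil>t\<rceil>"
      have "0 < t" "t \<le> real ?m + 1" "k \<le> ?m" using t by linarith+
      then have "t * t \<le> (real ?m + 1)\<^sup>2" by (simp add: power2_eq_square mult_mono)
      then have "ennreal t * ennreal t \<le> ennreal ((real ?m + 1)\<^sup>2)"
        using \<open>0 < t\<close> by (simp flip: ennreal_mult add: ennreal_leI)
      also have "\<dots> \<le> index_measure \<Delta> (A k \<inter> index_upto \<Delta> (s k ?m))" by (rule s)
      also have "\<dots> \<le> index_measure \<Delta> (A k \<inter> index_upto \<Delta> (f t))"
      proof (rule index_measure_mono)
        have "s k ?m \<le> f t" using s_le[OF \<open>k \<le> ?m\<close>] \<open>0 < t\<close> by (simp add: f_def)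
        then show "A k \<inter> index_upto \<Delta> (s k ?m) \<subseteq> A k \<inter> index_upto \<Delta> (f t)"
          by (auto simp: index_upto_def)
        show "A k \<inter> index_upto \<Delta> (f t) \<in> sets borel"
          using A closed_index_upto[OF \<Delta>] by auto
      qed
      finally have "ennreal t * ennreal t / ennreal t \<le> index_measure \<Delta> (A k \<inter> index_upto \<Delta> (f t)) / ennreal t"
        by (rule divide_right_mono_ennreal)
      moreover have "ennreal t * ennreal t / ennreal t = ennreal t"
        using \<open>0 < t\<close> by (simp flip: ennreal_mult add: divide_ennreal)
      ultimately show ?thesis by simp
    qed
    have le: "ennreal C \<le> lower_density \<Delta> f (A k)" for C
      unfolding lower_density_def
    proof (rule Liminf_bounded)
      show "\<forall>\<^sub>F t in at_top. ennreal C \<le> index_measure \<Delta> (A k \<inter> index_upto \<Delta> (f t)) / ennreal t"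
        using eventually_ge_at_top[of "max C (real k + 1)"]
      proof eventually_elim
        case (elim t)
        then have "C \<le> t" "real k + 1 \<le> t" by simp_all
        then show ?case using order_trans[OF ennreal_leI bound] by blast
      qed
    qed
    show "lower_density \<Delta> f (A k) = \<infinity>"
    proof (cases "lower_density \<Delta> f (A k)")
      case (real c)
      then show ?thesis using le[of "c + 1"] by (simp add: ennreal_le_iff)
    qed simp
  qed
qed

section \<open>Hitting sets\<close>

text \<open>Continuity of the orbit map makes the hitting set relatively open in the closed set
  \<open>\<Delta>\<close>.\<close>

lemma hitting_set_borel:
  assumes "\<Delta> \<in> index_sets" "C0_semigroup smul \<Delta> T" "open V"
  shows "hitting_set \<Delta> T x V \<in> sets borel"
proof -
  have "continuous_on \<Delta> (\<lambda>t. T t x)" using assms by (simp add: C0_semigroup_def)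
  then have "openin (top_of_set \<Delta>) (\<Delta> \<inter> (\<lambda>t. T t x) -` V)"
    using \<open>open V\<close> by (rule continuous_openin_preimage_gen)
  then obtain U where U: "open U" "\<Delta> \<inter> (\<lambda>t. T t x) -` V = \<Delta> \<inter> U"
    by (auto simp: openin_open)
  have "hitting_set \<Delta> T x V = \<Delta> \<inter> U"
    unfolding U(2)[symmetric] hitting_set_def by blast
  then show ?thesis using U(1) closed_index_set[OF assms(1)] by auto
qed

context graded_frechet_space
begin

text \<open>\<open>F n\<close> consists of the points that all \<open>T s\<close> with
  \<open>\<bar>s\<bar> \<le> 1 / (n + 1)\<close> send into a closed ball inside \<open>V\<close>.
  Continuity of orbits at time 0 shows that these closed sets cover a smaller open ball, so Baire
  applies. This takes the place of local equicontinuity.\<close>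

lemma uniform_hitting:
  assumes "\<Delta> \<in> index_sets" "C0_semigroup smul \<Delta> T" "open V" "V \<noteq> {}"
  obtains W \<delta> where "open W" "W \<noteq> {}" "0 < \<delta>"
    "\<And>y s. y \<in> W \<Longrightarrow> s \<in> index_upto \<Delta> \<delta> \<Longrightarrow> T s y \<in> V"
proof -
  obtain v where "v \<in> V" using assms(4) by blast
  then obtain N where "{y. r N (y - v) \<le> 1} \<subseteq> V"
    using open_contains_r_cball[OF \<open>open V\<close>, of v 0] by blast
  define C where "C = {y. r N (y - v) \<le> 1}"
  define U where "U = {y. r N (y - v) < 1}"
  have C: "closed C" "C \<subseteq> V" unfolding C_def by (rule closed_r_cball, fact)
  have U: "open U" "v \<in> U" "U \<subseteq> C" unfolding U_def C_def using open_r_ball by auto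
  define F where "F n = (\<Inter>s\<in>index_upto \<Delta> (1 / real (Suc n)). T s -` C)" for n
  have "closed (F n)" for n
    unfolding F_def
  proof (intro closed_INT ballI)
    fix s assume "s \<in> index_upto \<Delta> (1 / real (Suc n))"
    then have "continuous_on UNIV (T s)"
      using assms(2) by (simp add: C0_semigroup_def index_upto_def)
    then show "closed (T s -` C)"
      using \<open>closed C\<close> by (simp add: continuous_on_closed_vimage)
  qed
  moreover have "U \<subseteq> (\<Union>n. F n)"
  proof
    fix y assume "y \<in> U"
    have "continuous_on \<Delta> (\<lambda>t. T t y)" "T 0 y = y" using assms(2) by (simp_all add: C0_semigroup_def)
    then obtain A where A: "open A" "0 \<in> A" "\<And>t. t \<in> \<Delta> \<Longrightarrow> t \<in> A \<Longrightarrow> T t y \<in> U"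
      using zero_in_index_set[OF assms(1)] \<open>open U\<close> \<open>y \<in> U\<close>
      unfolding continuous_on_topological by (metis (full_types))
    obtain e where e: "0 < e" "ball 0 e \<subseteq> A" using A open_contains_ball by blast
    obtain n where n: "1 / real (Suc n) < e" using nat_approx_posE[OF e(1)] by auto
    have "y \<in> F n"
      unfolding F_def
    proof (intro INT_I vimageI2)
      fix s assume s: "s \<in> index_upto \<Delta> (1 / real (Suc n))"
      then have "s \<in> ball 0 e" using n by (simp add: index_upto_def)
      then have "s \<in> A" "s \<in> \<Delta>" using e s by (auto simp: index_upto_def)
      then show "T s y \<in> C" using A(3)[of s] U(3) by blast
    qed
    then show "y \<in> (\<Union>n. F n)" by blast
  qed
  ultimately obtain n W where W: "open W" "W \<noteq> {}" "W \<subseteq> F n"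
    using baire[of U F] U by blast
  have "T s y \<in> V" if "y \<in> W" "s \<in> index_upto \<Delta> (1 / real (Suc n))" for y s
    using that W C unfolding F_def by blast
  then show thesis using that[of W "1 / real (Suc n)"] W by simp
qed

lemma unbounded_hitting_set:
  assumes "infinite_dimensional smul" "\<Delta> \<in> index_sets" "C0_semigroup smul \<Delta> T"
    and hits: "\<And>V. open V \<Longrightarrow> V \<noteq> {} \<Longrightarrow> hitting_set \<Delta> T x V \<noteq> {}"
    and "open W" "W \<noteq> {}"
  obtains t where "t \<in> hitting_set \<Delta> T x W" "R < norm t"
proof (rule ccontr)
  assume "\<not> thesis"
  then have le: "norm t \<le> R" if "t \<in> hitting_set \<Delta> T x W" for t
    using that \<open>\<And>t. t \<in> hitting_set \<Delta> T x W \<Longrightarrow> R < norm t \<Longrightarrow> thesis\<close> by force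
  let ?K = "(\<lambda>t. T t x) ` index_upto \<Delta> R"
  have "continuous_on (index_upto \<Delta> R) (\<lambda>t. T t x)"
    using assms(3) by (auto simp: C0_semigroup_def index_upto_def intro: continuous_on_subset)
  then have K: "compact ?K" using compact_index_upto[OF assms(2)] by (intro compact_continuous_image)
  have "W \<subseteq> ?K"
  proof (rule ccontr)
    assume "\<not> W \<subseteq> ?K"
    \<comment> \<open>If nonempty, this open set would be hit at some time, which would be a hitting
      time of \<open>W\<close> of modulus greater than \<open>R\<close>.\<close>
    moreover have "open (W - ?K)" using \<open>open W\<close> compact_closed[OF K] by (rule open_Diff)
    ultimately obtain t where "t \<in> hitting_set \<Delta> T x (W - ?K)" using hits[of "W - ?K"] by blast
    then have "t \<in> hitting_set \<Delta> T x W" "t \<in> \<Delta>" "T t x \<notin> ?K" by (auto simp: hitting_set_def)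
    then show False using le[of t] by (auto simp: index_upto_def)
  qed
  then show False
    using finite_dimensional_if_compact_neighbourhood[OF K] assms by blast
qed

text \<open>Induction on the number \<open>n\<close> of disjoint translates of one piece of measure
  \<open>c\<close> that fit into a bounded part of the hitting set.\<close>

lemma hitting_set_measure_unbounded:
  assumes "infinite_dimensional smul" "\<Delta> \<in> index_sets" "C0_semigroup smul \<Delta> T"
    and hits: "\<And>V. open V \<Longrightarrow> V \<noteq> {} \<Longrightarrow> hitting_set \<Delta> T x V \<noteq> {}"
    and "open V" "V \<noteq> {}"
  shows "\<exists>s. ennreal C \<le> index_measure \<Delta> (hitting_set \<Delta> T x V \<inter> index_upto \<Delta> s)"
proof -
  obtain W \<delta> where W: "open W" "W \<noteq> {}" and \<delta>: "0 < \<delta>"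
    and hit: "\<And>y s. y \<in> W \<Longrightarrow> s \<in> index_upto \<Delta> \<delta> \<Longrightarrow> T s y \<in> V"
    using uniform_hitting[OF assms(2,3,5,6)] by metis
  obtain S c where S: "closed S" "S \<subseteq> index_upto \<Delta> \<delta>" and c: "0 < c"
    and piece: "\<And>t. t \<in> \<Delta> \<Longrightarrow> index_measure \<Delta> ((+) t ` S) = ennreal c"
    using index_set_piece[OF assms(2) \<delta>] by metis
  let ?A = "\<lambda>s. hitting_set \<Delta> T x V \<inter> index_upto \<Delta> s"
  have borel: "?A s \<in> sets borel" for s
    using hitting_set_borel[OF assms(2,3,5)] closed_index_upto[OF assms(2)] by auto
  have "\<exists>s. ennreal (real n * c) \<le> index_measure \<Delta> (?A s)" for n
  proof (induction n)
    case (Suc n)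
    then obtain s where s: "ennreal (real n * c) \<le> index_measure \<Delta> (?A s)" by blast
    \<comment> \<open>Every \<open>u\<close> in \<open>S\<close> has modulus at most \<delta>, so
      the margin \<open>s + \<delta>\<close> keeps the translate \<open>t + S\<close> outside the
      part of radius \<open>s\<close> already used.\<close>
    obtain t where t: "t \<in> hitting_set \<Delta> T x W" "s + \<delta> < norm t"
      by (rule unbounded_hitting_set[OF assms(1-4) W])
    have "t \<in> \<Delta>" using t by (simp add: hitting_set_def)
    have translate: "t + u \<in> hitting_set \<Delta> T x V" "s < norm (t + u)" "norm (t + u) \<le> norm t + \<delta>"
      if "u \<in> S" for u
    proof -
      have u: "u \<in> \<Delta>" "norm u \<le> \<delta>" "u \<in> index_upto \<Delta> \<delta>" using that S by (auto simp: index_upto_def)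
      have "T (u + t) = T u \<circ> T t" using assms(3) u(1) \<open>t \<in> \<Delta>\<close> by (simp add: C0_semigroup_def)
      then show "t + u \<in> hitting_set \<Delta> T x V"
        using hit[OF _ u(3), of "T t x"] t(1) add_in_index_set[OF assms(2) \<open>t \<in> \<Delta>\<close> u(1)]
        by (simp add: hitting_set_def add.commute)
      show "s < norm (t + u)" using norm_diff_ineq[of t u] t(2) u(2) by linarith
      show "norm (t + u) \<le> norm t + \<delta>" using norm_triangle_ineq[of t u] u(2) by linarith
    qed
    have "ennreal (real (Suc n) * c) = ennreal (real n * c) + ennreal c"
      using c by (simp flip: ennreal_plus add: algebra_simps)
    also have "\<dots> \<le> index_measure \<Delta> (?A s) + index_measure \<Delta> ((+) t ` S)"
      unfolding piece[OF \<open>t \<in> \<Delta>\<close>] by (intro add_mono s order_refl)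
    also have "\<dots> = index_measure \<Delta> (?A s \<union> (+) t ` S)"
    proof (rule index_measure_Un[symmetric, OF borel])
      show "(+) t ` S \<in> sets borel" using closed_translation[OF S(1)] by auto
      show "?A s \<inter> (+) t ` S = {}" using translate(2) by (fastforce simp: index_upto_def)
    qed
    also have "\<dots> \<le> index_measure \<Delta> (?A (norm t + \<delta>))"
    proof (rule index_measure_mono[OF _ borel])
      show "?A s \<union> (+) t ` S \<subseteq> ?A (norm t + \<delta>)"
        using translate t(2) \<delta> by (auto simp: index_upto_def hitting_set_def)
    qed
    finally show ?case by blast
  qed simp
  moreover obtain n where "C \<le> real n * c"
    using reals_Archimedean3[OF c] less_imp_le by blast
  ultimately show ?thesis using ennreal_leI order_trans by metis
qed

end

section \<open>From the countable family to all nonempty open sets\<close>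

theorem proposition2p7:
  fixes smul :: "'k::real_normed_field \<Rightarrow> 'e::{ab_group_add, topological_space} \<Rightarrow> 'e"
    and \<Delta> :: "complex set"
    and T :: "complex \<Rightarrow> 'e \<Rightarrow> 'e"
  assumes "frechet_space smul"
    and "separable_space (euclidean :: 'e topology)"
    and "infinite_dimensional smul"
    and "\<Delta> \<in> index_sets"
    and "C0_semigroup smul \<Delta> T"
    and "hypercyclic \<Delta> T"
  shows "\<exists>f x. f \<in> {0..} \<rightarrow> {1..} \<and> strict_mono_on {0..} f \<and>
    freq_hypercyclic \<Delta> f T \<and> freq_hypercyclic_vector \<Delta> f T x \<and>
    (\<forall>V. open V \<and> V \<noteq> {} \<longrightarrow> lower_density \<Delta> f (hitting_set \<Delta> T x V) = \<infinity>)"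
proof -
  obtain r where "graded_frechet_space smul r"
    using frechet_space.graded_frechet_space[OF assms(1)] by blast
  then interpret graded_frechet_space smul r .
  obtain x where x: "\<And>V. open V \<Longrightarrow> V \<noteq> {} \<Longrightarrow> hitting_set \<Delta> T x V \<noteq> {}"
    using assms(6) unfolding hypercyclic_def by blast
  obtain G :: "nat \<Rightarrow> 'e set" where G: "\<And>n. open (G n)" "\<And>n. G n \<noteq> {}"
    and base: "\<And>V. open V \<Longrightarrow> V \<noteq> {} \<Longrightarrow> \<exists>n. G n \<subseteq> V"
    using countable_pi_base[OF assms(2)] by blast
  have "hitting_set \<Delta> T x (G k) \<in> sets borel" for k
    by (rule hitting_set_borel[OF assms(4,5) G(1)])
  moreover have "\<exists>s. ennreal C \<le> index_measure \<Delta> (hitting_set \<Delta> T x (G k) \<inter> index_upto \<Delta> s)" for k C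
    by (rule hitting_set_measure_unbounded[OF assms(3-5) x G])
  ultimately obtain f where f: "f \<in> {0..} \<rightarrow> {1..}" "strict_mono_on {0..} f"
    and dens: "\<And>k. lower_density \<Delta> f (hitting_set \<Delta> T x (G k)) = \<infinity>"
    using infinite_lower_densities[OF assms(4), of "\<lambda>k. hitting_set \<Delta> T x (G k)"] by metis
  have inf: "lower_density \<Delta> f (hitting_set \<Delta> T x V) = \<infinity>" if V: "open V" "V \<noteq> {}" for V
  proof -
    obtain k where "G k \<subseteq> V" using base[OF V] by blast
    then have "hitting_set \<Delta> T x (G k) \<subseteq> hitting_set \<Delta> T x V" by (auto simp: hitting_set_def)
    then have "lower_density \<Delta> f (hitting_set \<Delta> T x (G k)) \<le> lower_density \<Delta> f (hitting_set \<Delta> T x V)"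
      by (rule lower_density_mono[OF assms(4) _ hitting_set_borel[OF assms(4,5) V(1)]])
    then show ?thesis unfolding dens by (simp add: top_unique)
  qed
  then have vec: "freq_hypercyclic_vector \<Delta> f T x" by (simp add: freq_hypercyclic_vector_def)
  then have "freq_hypercyclic \<Delta> f T" unfolding freq_hypercyclic_def by blast
  then show ?thesis using f vec inf by blast
qed

end
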